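(* Let $\lambda_{t-1}\in\mathbb R^Q$ be an outer iterate for which the problem $\mathrm{GDB}(\lambda_{t-1})$ is bounded and Slater's condition holds for its dual, i.e. there exists $\hat\beta\in\mathcal F(\lambda_{t-1})$ with $\mathbf C_{\lambda_{t-1}}(\hat\beta)\succ\frac{\hat\beta_k(\gamma_k+1)}{\gamma_k}\mathbf h_k\mathbf h_k^{H}$ for all $k=1,\dots,K$. Let $\beta^\star_{t-1}$ be the optimal solution of the dual of $\mathrm{GDB}(\lambda_{t-1})$, and let $\lambda_t=\lambda_{t-1}+\bar\alpha\,g$, where $\bar\alpha>0$ is the outer step size and $g=\nabla\tilde d(\lambda_{t-1})$ is the update direction. When the outer step size is sufficiently small (i.e. there is $\bar\alpha_0>0$ such that for all $0<\bar\alpha\le\bar\alpha_0$), the warm-start initialization $\beta^{(0)}=\beta^\star_{t-1}$ satisfies $\beta^{(0)}\in\mathcal S(\lambda_t)$.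
   Context: Data: integers $K,M,Q\ge1$; vectors $\mathbf h_1,\dots,\mathbf h_K\in\mathbb C^M$; scalars $\gamma_k>0$, $\sigma_k^2>0$, $\eta>0$; Hermitian matrices $\mathbf M_1,\dots,\mathbf M_Q\in\mathbb C^{M\times M}$. For $\lambda\in\mathbb R^Q$, $\mathbf B(\lambda)=\mathbf I-2\sum_{q=1}^Q\lambda_q\mathbf M_q$ and $\mathbf C_\lambda(\beta)=\mathbf B(\lambda)+\sum_{j=1}^K\beta_j\mathbf h_j\mathbf h_j^{H}$. $\mathrm{GDB}(\lambda)$: minimize $\operatorname{tr}(\mathbf B(\lambda)\sum_k\mathbf V_k)$ over Hermitian $\mathbf V_1,\dots,\mathbf V_K\succeq0$ subject to $(1+\frac1{\gamma_k})\mathbf h_k^{H}\mathbf V_k\mathbf h_k\ge\sum_{j=1}^K\mathbf h_k^{H}\mathbf V_j\mathbf h_k+\sigma_k^2$ for all $k$. The constraints are assumed feasible; "bounded" means the optimal value $d(\lambda)$ is $>-\infty$. Put $\tilde d(\lambda)=d(\lambda)-2\sqrt{Q\eta}\|\lambda\|$, a concave function; $\nabla\tilde d(\lambda)$ denotes its gradient (a supergradient where it is not differentiable). Dual of $\mathrm{GDB}(\lambda)$: maximize $\sum_k\beta_k\sigma_k^2$ over $\beta\ge0$ subject to $\mathbf C_\lambda(\beta)\succeq\frac{\beta_k(\gamma_k+1)}{\gamma_k}\mathbf h_k\mathbf h_k^{H}$ for all $k$. $I_\lambda(\beta)$ has components $I_{\lambda,k}(\beta)=\frac{\gamma_k}{\gamma_k+1}\frac1{\mathbf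 h_k^{H}\mathbf C_\lambda(\beta)^{-1}\mathbf h_k}$ (pseudoinverse if $\mathbf C_\lambda(\beta)\succeq0$ is singular with all $\mathbf h_k$ in its range). $\mathcal F_1(\lambda)=\{\beta\ge0:\mathbf C_\lambda(\beta)\succeq0,\ \mathbf h_1,\dots,\mathbf h_K\in\operatorname{range}\mathbf C_\lambda(\beta)\}$; $\mathcal F(\lambda)=\mathcal F_1(\lambda)\cap\{\beta\le I_\lambda(\beta)\}$. The convergent initialization region is $$\mathcal S(\lambda)=\bigcup\big\{\{\beta:\beta\ge\hat\beta\}\ :\ \hat\beta\in\mathcal F(\lambda),\ \hat\beta<I_\lambda(\hat\beta)\big\}.$$ Vector inequalities are component-wise. *)

theory Defs
  imports "HOL-Analysis.Analysis"
begin

definition cdot :: "complex ^ 'm::finite \<Rightarrow> complex ^ 'm \<Rightarrow> complex" where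
  "cdot x y = (\<Sum>i\<in>UNIV. cnj (x $ i) * y $ i)"

definition conj_transpose :: "complex ^ 'm::finite ^ 'm \<Rightarrow> complex ^ 'm ^ 'm" where
  "conj_transpose A = (\<chi> i j. cnj (A $ j $ i))"

definition hermitian :: "complex ^ 'm::finite ^ 'm \<Rightarrow> bool" where
  "hermitian A \<longleftrightarrow> conj_transpose A = A"

text \<open>For Hermitian \<open>A\<close> the number \<open>x\<^sup>H A x\<close> is real, so taking \<open>Re\<close> loses nothing.\<close>

definition quad :: "complex ^ 'm::finite ^ 'm \<Rightarrow> complex ^ 'm \<Rightarrow> real" where
  "quad A x = Re (cdot x (A *v x))"

definition psd :: "complex ^ 'm::finite ^ 'm \<Rightarrow> bool" where
  "psd A \<longleftrightarrow> hermitian A \<and> (\<forall>x. 0 \<le> quad A x)"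

definition posdef :: "complex ^ 'm::finite ^ 'm \<Rightarrow> bool" where
  "posdef A \<longleftrightarrow> hermitian A \<and> (\<forall>x. x \<noteq> 0 \<longrightarrow> 0 < quad A x)"

definition loewner_ge :: "complex ^ 'm::finite ^ 'm \<Rightarrow> complex ^ 'm ^ 'm \<Rightarrow> bool" where
  "loewner_ge A B \<longleftrightarrow> psd (A - B)"

definition loewner_gt :: "complex ^ 'm::finite ^ 'm \<Rightarrow> complex ^ 'm ^ 'm \<Rightarrow> bool" where
  "loewner_gt A B \<longleftrightarrow> posdef (A - B)"

text \<open>The rank-one matrix \<open>h h\<^sup>H\<close>.\<close>

definition outer :: "complex ^ 'm::finite \<Rightarrow> complex ^ 'm ^ 'm" where
  "outer h = (\<chi> i j. h $ i * cnj (h $ j))"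

text \<open>The Moore--Penrose pseudoinverse, by the four Penrose equations.\<close>

definition pseudoinverse :: "complex ^ 'm::finite ^ 'm \<Rightarrow> complex ^ 'm ^ 'm" where
  "pseudoinverse A = (THE X. A ** X ** A = A \<and> X ** A ** X = X
     \<and> hermitian (A ** X) \<and> hermitian (X ** A))"

definition B_mat :: "('q::finite \<Rightarrow> complex ^ 'm::finite ^ 'm) \<Rightarrow> real ^ 'q \<Rightarrow> complex ^ 'm ^ 'm" where
  "B_mat M lam = mat 1 - 2 *\<^sub>R (\<Sum>q\<in>UNIV. (lam $ q) *\<^sub>R M q)"

definition C_mat :: "('k::finite \<Rightarrow> complex ^ 'm::finite) \<Rightarrow> ('q::finite \<Rightarrow> complex ^ 'm ^ 'm)
    \<Rightarrow> real ^ 'q \<Rightarrow> real ^ 'k \<Rightarrow> complex ^ 'm ^ 'm" where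
  "C_mat h M lam \<beta> = B_mat M lam + (\<Sum>j\<in>UNIV. (\<beta> $ j) *\<^sub>R outer (h j))"

definition GDB_feasible :: "('k::finite \<Rightarrow> complex ^ 'm::finite) \<Rightarrow> ('k \<Rightarrow> real) \<Rightarrow> ('k \<Rightarrow> real)
    \<Rightarrow> ('k \<Rightarrow> complex ^ 'm ^ 'm) set" where
  "GDB_feasible h \<gamma> \<sigma>sq = {V. (\<forall>k. psd (V k)) \<and>
     (\<forall>k. (1 + 1 / \<gamma> k) * quad (V k) (h k) \<ge> (\<Sum>j\<in>UNIV. quad (V j) (h k)) + \<sigma>sq k)}"

text \<open>The trace is real for Hermitian \<open>M q\<close> and \<open>V k\<close>.\<close>

definition GDB_objective :: "('q::finite \<Rightarrow> complex ^ 'm::finite ^ 'm) \<Rightarrow> real ^ 'q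
    \<Rightarrow> ('k::finite \<Rightarrow> complex ^ 'm ^ 'm) \<Rightarrow> real" where
  "GDB_objective M lam V = Re (trace (B_mat M lam ** (\<Sum>k\<in>UNIV. V k)))"

definition d_opt :: "('k::finite \<Rightarrow> complex ^ 'm::finite) \<Rightarrow> ('k \<Rightarrow> real) \<Rightarrow> ('k \<Rightarrow> real)
    \<Rightarrow> ('q::finite \<Rightarrow> complex ^ 'm ^ 'm) \<Rightarrow> real ^ 'q \<Rightarrow> ereal" where
  "d_opt h \<gamma> \<sigma>sq M lam = (INF V\<in>GDB_feasible h \<gamma> \<sigma>sq. ereal (GDB_objective M lam V))"

definition GDB_bounded :: "('k::finite \<Rightarrow> complex ^ 'm::finite) \<Rightarrow> ('k \<Rightarrow> real) \<Rightarrow> ('k \<Rightarrow> real)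
    \<Rightarrow> ('q::finite \<Rightarrow> complex ^ 'm ^ 'm) \<Rightarrow> real ^ 'q \<Rightarrow> bool" where
  "GDB_bounded h \<gamma> \<sigma>sq M lam \<longleftrightarrow> d_opt h \<gamma> \<sigma>sq M lam > - \<infinity>"

definition d_tilde :: "('k::finite \<Rightarrow> complex ^ 'm::finite) \<Rightarrow> ('k \<Rightarrow> real) \<Rightarrow> ('k \<Rightarrow> real)
    \<Rightarrow> ('q::finite \<Rightarrow> complex ^ 'm ^ 'm) \<Rightarrow> real \<Rightarrow> real ^ 'q \<Rightarrow> ereal" where
  "d_tilde h \<gamma> \<sigma>sq M \<eta> lam =
     d_opt h \<gamma> \<sigma>sq M lam - ereal (2 * sqrt (real CARD('q) * \<eta>) * norm lam)"

definition has_gradient_at :: "('a::euclidean_space \<Rightarrow> ereal) \<Rightarrow> 'a \<Rightarrow> 'a \<Rightarrow> bool" where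
  "has_gradient_at f g x \<longleftrightarrow> (\<forall>\<^sub>F y in nhds x. \<bar>f y\<bar> \<noteq> \<infinity>) \<and>
     (GDERIV (\<lambda>y. real_of_ereal (f y)) x :> g)"

definition supergradient_at :: "('a::euclidean_space \<Rightarrow> ereal) \<Rightarrow> 'a \<Rightarrow> 'a \<Rightarrow> bool" where
  "supergradient_at f g x \<longleftrightarrow> \<bar>f x\<bar> \<noteq> \<infinity> \<and> (\<forall>y. f y \<le> f x + ereal (g \<bullet> (y - x)))"

text \<open>The gradient where it exists, and otherwise an arbitrary supergradient.\<close>

definition update_direction :: "('a::euclidean_space \<Rightarrow> ereal) \<Rightarrow> 'a \<Rightarrow> 'a \<Rightarrow> bool" where
  "update_direction f g x \<longleftrightarrow>
     (if \<exists>g'. has_gradient_at f g' x then has_gradient_at f g x else supergradient_at f g x)"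

text \<open>The library order \<open>\<le>\<close> on vectors is component-wise, but \<open>x < y\<close> there means
  \<open>x \<le> y \<and> x \<noteq> y\<close>; strict vector inequalities are therefore spelled out below.\<close>

definition dual_feasible :: "('k::finite \<Rightarrow> complex ^ 'm::finite) \<Rightarrow> ('k \<Rightarrow> real)
    \<Rightarrow> ('q::finite \<Rightarrow> complex ^ 'm ^ 'm) \<Rightarrow> real ^ 'q \<Rightarrow> (real ^ 'k) set" where
  "dual_feasible h \<gamma> M lam = {\<beta>. 0 \<le> \<beta> \<and>
     (\<forall>k. loewner_ge (C_mat h M lam \<beta>) ((\<beta> $ k * (\<gamma> k + 1) / \<gamma> k) *\<^sub>R outer (h k)))}"

definition dual_optimal :: "('k::finite \<Rightarrow> complex ^ 'm::finite) \<Rightarrow> ('k \<Rightarrow> real) \<Rightarrow> ('k \<Rightarrow> real)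
    \<Rightarrow> ('q::finite \<Rightarrow> complex ^ 'm ^ 'm) \<Rightarrow> real ^ 'q \<Rightarrow> real ^ 'k \<Rightarrow> bool" where
  "dual_optimal h \<gamma> \<sigma>sq M lam \<beta> \<longleftrightarrow> \<beta> \<in> dual_feasible h \<gamma> M lam \<and>
     (\<forall>\<beta>'\<in>dual_feasible h \<gamma> M lam. (\<Sum>k\<in>UNIV. \<beta>' $ k * \<sigma>sq k) \<le> (\<Sum>k\<in>UNIV. \<beta> $ k * \<sigma>sq k))"

text \<open>If \<open>h k \<noteq> 0\<close> lies in the range of \<open>C_mat h M lam \<beta>\<close> and that matrix is positive
  semidefinite, then the denominator below is positive. Feasibility of the constraints of GDB
  with \<open>\<sigma>sq k > 0\<close> forces \<open>h k \<noteq> 0\<close>.\<close>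

definition I_map :: "('k::finite \<Rightarrow> complex ^ 'm::finite) \<Rightarrow> ('k \<Rightarrow> real)
    \<Rightarrow> ('q::finite \<Rightarrow> complex ^ 'm ^ 'm) \<Rightarrow> real ^ 'q \<Rightarrow> real ^ 'k \<Rightarrow> real ^ 'k" where
  "I_map h \<gamma> M lam \<beta> =
     (let C = C_mat h M lam \<beta>; X = (if invertible C then matrix_inv C else pseudoinverse C)
      in \<chi> k. \<gamma> k / (\<gamma> k + 1) * (1 / quad X (h k)))"

definition F1_set :: "('k::finite \<Rightarrow> complex ^ 'm::finite) \<Rightarrow> ('q::finite \<Rightarrow> complex ^ 'm ^ 'm)
    \<Rightarrow> real ^ 'q \<Rightarrow> (real ^ 'k) set" where
  "F1_set h M lam = {\<beta>. 0 \<le> \<beta> \<and> psd (C_mat h M lam \<beta>) \<and>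
     (\<forall>k. h k \<in> range (\<lambda>x. C_mat h M lam \<beta> *v x))}"

definition F_set :: "('k::finite \<Rightarrow> complex ^ 'm::finite) \<Rightarrow> ('k \<Rightarrow> real)
    \<Rightarrow> ('q::finite \<Rightarrow> complex ^ 'm ^ 'm) \<Rightarrow> real ^ 'q \<Rightarrow> (real ^ 'k) set" where
  "F_set h \<gamma> M lam = F1_set h M lam \<inter> {\<beta>. \<beta> \<le> I_map h \<gamma> M lam \<beta>}"

definition S_set :: "('k::finite \<Rightarrow> complex ^ 'm::finite) \<Rightarrow> ('k \<Rightarrow> real)
    \<Rightarrow> ('q::finite \<Rightarrow> complex ^ 'm ^ 'm) \<Rightarrow> real ^ 'q \<Rightarrow> (real ^ 'k) set" where
  "S_set h \<gamma> M lam = \<Union> {{\<beta>. \<beta> \<ge> \<beta>h} | \<beta>h.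
     \<beta>h \<in> F_set h \<gamma> M lam \<and> (\<forall>k. \<beta>h $ k < I_map h \<gamma> M lam \<beta>h $ k)}"

definition dual_slater :: "('k::finite \<Rightarrow> complex ^ 'm::finite) \<Rightarrow> ('k \<Rightarrow> real)
    \<Rightarrow> ('q::finite \<Rightarrow> complex ^ 'm ^ 'm) \<Rightarrow> real ^ 'q \<Rightarrow> bool" where
  "dual_slater h \<gamma> M lam \<longleftrightarrow> (\<exists>\<beta>\<in>F_set h \<gamma> M lam.
     \<forall>k. loewner_gt (C_mat h M lam \<beta>) ((\<beta> $ k * (\<gamma> k + 1) / \<gamma> k) *\<^sub>R outer (h k)))"

end

theory Submission imports Defs begin

text \<open>Dual feasibility is closed under componentwise maxima, because \<open>C_mat\<close> is monotone in
  \<open>\<beta>\<close>. Since the weights \<open>\<sigma>sq\<close> are positive, the dual optimum therefore dominates every dual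
  feasible point, in particular the Slater point \<open>\<beta>h\<close>. Strict feasibility of \<open>\<beta>h\<close> is an open
  condition in \<open>lam\<close>, hence survives a small step in any direction, and it implies
  \<open>\<beta>h < I_map \<beta>h\<close>. So \<open>\<beta>h\<close> itself witnesses that the optimum lies in the new region.\<close>

section \<open>Algebra of quadratic forms and Hermitian matrices\<close>

lemma quad_add: "quad (A + B) x = quad A x + quad B x"
  by (simp add: quad_def cdot_def matrix_vector_mult_add_rdistrib distrib_left sum.distrib)

lemma quad_diff: "quad (A - B) x = quad A x - quad B x"
  by (simp add: quad_def cdot_def matrix_vector_mult_diff_rdistrib right_diff_distrib sum_subtractf)

lemma quad_scaleR: "quad (r *\<^sub>R A) x = r * quad A x"
  by (simp add: quad_def cdot_def matrix_vector_mult_def scaleR_sum_right[symmetric])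

lemma quad_sum: "quad (\<Sum>j\<in>S. A j) x = (\<Sum>j\<in>S. quad (A j) x)"
  by (induction S rule: infinite_finite_induct)
    (simp_all add: quad_add, simp_all add: quad_def cdot_def)

lemma quad_zero_right [simp]: "quad A 0 = 0"
  by (simp add: quad_def cdot_def)

lemma psd_posdef: "posdef A \<Longrightarrow> psd A"
  unfolding posdef_def psd_def by (metis less_imp_le order_refl quad_zero_right)

lemma quad_scaleR_right: "quad A (r *\<^sub>R x) = r\<^sup>2 * quad A x"
  by (simp add: quad_def cdot_def matrix_vector_mult_def scaleR_sum_right[symmetric]
      power2_eq_square mult.assoc)

lemma cdot_commute: "cdot x y = cnj (cdot y x)"
  by (simp add: cdot_def mult.commute)

lemma quad_outer: "quad (outer h) x = (cmod (cdot h x))\<^sup>2"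
proof -
  have "outer h *v x = (\<chi> i. h $ i * cdot h x)"
    by (simp add: outer_def matrix_vector_mult_def cdot_def sum_distrib_left mult.assoc)
  then have "cdot x (outer h *v x) = cdot x h * cdot h x"
    by (simp add: cdot_def sum_distrib_right mult.assoc)
  also have "\<dots> = complex_of_real ((cmod (cdot h x))\<^sup>2)"
    by (subst cdot_commute) (simp only: complex_norm_square mult.commute)
  finally show ?thesis
    by (simp add: quad_def)
qed

lemma hermitian_iff: "hermitian A \<longleftrightarrow> (\<forall>i j. cnj (A $ j $ i) = A $ i $ j)"
  by (simp add: hermitian_def conj_transpose_def vec_eq_iff)

lemma hermitian_add: "hermitian A \<Longrightarrow> hermitian B \<Longrightarrow> hermitian (A + B)"
  and hermitian_diff: "hermitian A \<Longrightarrow> hermitian B \<Longrightarrow> hermitian (A - B)"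
  and hermitian_scaleR: "hermitian A \<Longrightarrow> hermitian (r *\<^sub>R A)"
  by (simp_all add: hermitian_iff)

lemma hermitian_sum: "(\<And>j. j \<in> S \<Longrightarrow> hermitian (A j)) \<Longrightarrow> hermitian (\<Sum>j\<in>S. A j)"
  by (simp add: hermitian_iff)

lemma hermitian_outer: "hermitian (outer h)"
  by (simp add: hermitian_iff outer_def mult.commute)

section \<open>Dependence of \<open>C_mat\<close> on \<open>\<beta>\<close> and on
  \<open>lam\<close>\<close>

lemma hermitian_C_mat:
  assumes "\<And>q. hermitian (M q)"
  shows "hermitian (C_mat h M lam \<beta>)"
proof -
  have "hermitian (mat 1)"
    by (simp add: hermitian_iff mat_def)
  then show ?thesis
    unfolding C_mat_def B_mat_def
    by (intro hermitian_add hermitian_diff hermitian_scaleR hermitian_sum hermitian_outer assms)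
qed

lemma quad_C_mat:
  "quad (C_mat h M lam \<beta>) x
    = quad (B_mat M lam) x + (\<Sum>j\<in>UNIV. \<beta> $ j * (cmod (cdot (h j) x))\<^sup>2)"
  by (simp add: C_mat_def quad_add quad_sum quad_scaleR quad_outer)

lemma quad_C_mat_mono:
  assumes "\<beta> \<le> \<beta>'"
  shows "quad (C_mat h M lam \<beta>) x \<le> quad (C_mat h M lam \<beta>') x"
  using assms by (auto simp: quad_C_mat less_eq_vec_def intro!: sum_mono mult_right_mono)

text \<open>\<open>B_mat\<close> is affine in \<open>lam\<close>, so moving along \<open>g\<close>
  adds a multiple of one fixed matrix; this puts the outer step into the form that
  \<open>posdef_perturb\<close> handles.\<close>

lemma C_mat_step:
  "C_mat h M (lam + \<alpha> *\<^sub>R g) \<beta>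
    = C_mat h M lam \<beta> + \<alpha> *\<^sub>R (- 2 *\<^sub>R (\<Sum>q\<in>UNIV. (g $ q) *\<^sub>R M q))"
proof -
  have "(\<Sum>q\<in>UNIV. ((lam + \<alpha> *\<^sub>R g) $ q) *\<^sub>R M q)
      = (\<Sum>q\<in>UNIV. (lam $ q) *\<^sub>R M q) + \<alpha> *\<^sub>R (\<Sum>q\<in>UNIV. (g $ q) *\<^sub>R M q)"
    by (simp add: scaleR_add_left sum.distrib scaleR_sum_right)
  then show ?thesis
    by (simp add: C_mat_def B_mat_def scaleR_add_right)
qed

section \<open>The dual feasible set and its greatest element\<close>

lemma dual_feasible_iff:
  assumes "\<And>q. hermitian (M q)"
  shows "\<beta> \<in> dual_feasible h \<gamma> M lam \<longleftrightarrow> 0 \<le> \<beta> \<and>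
    (\<forall>k x. \<beta> $ k * (\<gamma> k + 1) / \<gamma> k * (cmod (cdot (h k) x))\<^sup>2 \<le> quad (C_mat h M lam \<beta>) x)"
  by (simp add: dual_feasible_def loewner_ge_def psd_def quad_diff quad_scaleR quad_outer
      hermitian_diff hermitian_scaleR hermitian_outer hermitian_C_mat assms)

text \<open>For each \<open>k\<close> the maximum equals \<open>\<beta> $ k\<close> or
  \<open>\<beta>' $ k\<close>, so the left side of the \<open>k\<close>-th constraint is one already
  bounded at that point; passing to the maximum can only enlarge the right side.\<close>

lemma dual_feasible_max:
  assumes herm: "\<And>q. hermitian (M q)"
    and \<beta>: "\<beta> \<in> dual_feasible h \<gamma> M lam" and \<beta>': "\<beta>' \<in> dual_feasible h \<gamma> M lam"
  shows "(\<chi> k. max (\<beta> $ k) (\<beta>' $ k)) \<in> dual_feasible h \<gamma> M lam"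
proof -
  let ?m = "\<chi> k. max (\<beta> $ k) (\<beta>' $ k)"
  have le: "\<beta> \<le> ?m" "\<beta>' \<le> ?m"
    by (simp_all add: less_eq_vec_def)
  have "?m $ k * (\<gamma> k + 1) / \<gamma> k * (cmod (cdot (h k) x))\<^sup>2 \<le> quad (C_mat h M lam ?m) x" for k x
  proof -
    have "\<beta> $ k * (\<gamma> k + 1) / \<gamma> k * (cmod (cdot (h k) x))\<^sup>2 \<le> quad (C_mat h M lam ?m) x"
      using \<beta> quad_C_mat_mono[OF le(1)] order_trans unfolding dual_feasible_iff[OF herm] by blast
    moreover have "\<beta>' $ k * (\<gamma> k + 1) / \<gamma> k * (cmod (cdot (h k) x))\<^sup>2 \<le> quad (C_mat h M lam ?m) x"
      using \<beta>' quad_C_mat_mono[OF le(2)] order_trans unfolding dual_feasible_iff[OF herm] by blast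
    ultimately show ?thesis
      by (simp add: max_def)
  qed
  moreover have "0 \<le> ?m"
    using \<beta> le(1) order_trans unfolding dual_feasible_iff[OF herm] by blast
  ultimately show ?thesis
    unfolding dual_feasible_iff[OF herm] by blast
qed

text \<open>If some coordinate of \<open>\<beta>'\<close> exceeded that of \<open>\<beta>\<close>,
  their componentwise maximum would be feasible with a strictly larger objective, as every weight is
  positive.\<close>

lemma dual_optimal_greatest:
  assumes herm: "\<And>q. hermitian (M q)" and \<sigma>: "\<And>k. \<sigma>sq k > 0"
    and opt: "dual_optimal h \<gamma> \<sigma>sq M lam \<beta>" and \<beta>': "\<beta>' \<in> dual_feasible h \<gamma> M lam"
  shows "\<beta>' \<le> \<beta>"
proof (rule ccontr)
  assume "\<not> \<beta>' \<le> \<beta>"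
  then obtain k where k: "\<beta> $ k < \<beta>' $ k"
    by (auto simp: less_eq_vec_def not_le)
  let ?m = "\<chi> k. max (\<beta> $ k) (\<beta>' $ k)"
  have "(\<Sum>k\<in>UNIV. \<beta> $ k * \<sigma>sq k) < (\<Sum>k\<in>UNIV. ?m $ k * \<sigma>sq k)"
    by (rule sum_strict_mono_ex1)
      (use k \<sigma> in \<open>auto simp: mult_right_mono less_imp_le intro!: exI[of _ k]\<close>)
  moreover have "?m \<in> dual_feasible h \<gamma> M lam"
    using dual_feasible_max[OF herm _ \<beta>'] opt by (simp add: dual_optimal_def)
  ultimately show False
    using opt by (fastforce simp: dual_optimal_def)
qed

section \<open>Stability of positive definiteness\<close>

lemma continuous_on_quad: "continuous_on S (quad A)"
proof -
  have "quad A = (\<lambda>x. Re (\<Sum>i\<in>UNIV. cnj (x $ i) * (\<Sum>j\<in>UNIV. A $ i $ j * x $ j)))"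
    by (simp add: fun_eq_iff quad_def cdot_def matrix_vector_mult_def)
  then show ?thesis
    by (simp only:) (intro continuous_intros)
qed

text \<open>On the compact unit sphere both forms attain their minima, at \<open>a\<close> and
  \<open>b\<close>. For \<alpha> > 0 the perturbed form is bounded below there by
  \<open>quad D a + \<alpha> * quad N b\<close>, which tends to \<open>quad D a > 0\<close>. The
  sign of \<alpha> matters for this bound, hence the one-sided filter.\<close>

lemma posdef_perturb:
  fixes D N :: "complex ^ 'm::finite ^ 'm"
  assumes D: "posdef D" and N: "hermitian N"
  shows "\<forall>\<^sub>F \<alpha> in at_right 0. posdef (D + \<alpha> *\<^sub>R N)"
proof -
  let ?S = "sphere (0 :: complex ^ 'm) 1"
  obtain a where a: "a \<in> ?S" "\<And>x. x \<in> ?S \<Longrightarrow> quad D a \<le> quad D x"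
    using continuous_attains_inf[OF compact_sphere _ continuous_on_quad, of 0 1 D] by fastforce
  obtain b where b: "b \<in> ?S" "\<And>x. x \<in> ?S \<Longrightarrow> quad N b \<le> quad N x"
    using continuous_attains_inf[OF compact_sphere _ continuous_on_quad, of 0 1 N] by fastforce
  have "a \<noteq> 0"
    using a(1) by auto
  then have "0 < quad D a"
    using D by (simp add: posdef_def)
  moreover have "((\<lambda>\<alpha>. quad D a + \<alpha> * quad N b) \<longlongrightarrow> quad D a + 0 * quad N b) (at_right 0)"
    by (intro tendsto_intros)
  ultimately have "\<forall>\<^sub>F \<alpha> in at_right 0. 0 < quad D a + \<alpha> * quad N b"
    by (intro order_tendstoD(1)) auto
  then show ?thesis
    using eventually_at_right_less[of "0::real"]
  proof eventually_elim
    case (elim \<alpha>)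
    have "0 < quad (D + \<alpha> *\<^sub>R N) x" if "x \<noteq> 0" for x
    proof -
      \<comment> \<open>The form is homogeneous of degree two, so positivity at \<open>x\<close>
        follows from positivity at the normalized vector.\<close>
      let ?u = "(1 / norm x) *\<^sub>R x"
      have u: "?u \<in> ?S"
        using that by simp
      have "quad D a + \<alpha> * quad N b \<le> quad (D + \<alpha> *\<^sub>R N) ?u"
        unfolding quad_add quad_scaleR
        by (intro add_mono mult_left_mono a b u) (use elim in simp)
      then have "0 < (1 / norm x)\<^sup>2 * quad (D + \<alpha> *\<^sub>R N) x"
        using elim by (simp only: quad_scaleR_right)
      then show ?thesis
        by (simp add: zero_less_mult_iff zero_less_divide_iff)
    qed
    then show ?case
      using D N by (simp add: posdef_def hermitian_add hermitian_scaleR)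
  qed
qed

section \<open>From strict feasibility to the initialization region\<close>

lemma invertible_posdef:
  assumes "posdef A"
  shows "invertible A"
proof -
  have "x = 0" if "A *v x = 0" for x
    using assms that by (force simp: posdef_def quad_def cdot_def)
  then show ?thesis
    by (simp add: invertible_left_inverse matrix_left_invertible_ker)
qed

text \<open>With \<open>h k = 0\<close> every quadratic form in the \<open>k\<close>-th constraint
  vanishes and only \<open>0 \<ge> \<sigma>sq k\<close> remains.\<close>

lemma GDB_feasible_nonzero:
  assumes "V \<in> GDB_feasible h \<gamma> \<sigma>sq" and "\<sigma>sq k > 0"
  shows "h k \<noteq> 0"
proof
  assume "h k = 0"
  then have "0 \<ge> \<sigma>sq k"
    using assms(1) by (auto simp: GDB_feasible_def dest!: spec[of _ k])
  with assms(2) show False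
    by simp
qed

text \<open>The \<open>k\<close>-th strict constraint is tested at \<open>x\<close>, the inverse of
  \<open>C_mat\<close> applied to \<open>h k\<close>. With \<open>s\<close> the denominator in
  \<open>I_map\<close> and \<open>c\<close> the coefficient of \<open>outer (h k)\<close>, this
  gives \<open>c * s^2 < s\<close>, hence \<open>c * s < 1\<close>, which rearranges to the strict
  inequality.\<close>

lemma strictly_feasible_imp:
  assumes \<gamma>: "\<And>k. \<gamma> k > 0" and h: "\<And>k. h k \<noteq> 0" and herm: "\<And>q. hermitian (M q)"
    and \<beta>: "0 \<le> \<beta>"
    and pd: "\<And>k. loewner_gt (C_mat h M lam \<beta>) ((\<beta> $ k * (\<gamma> k + 1) / \<gamma> k) *\<^sub>R outer (h k))"
  shows "\<beta> \<in> F_set h \<gamma> M lam" and "\<And>k. \<beta> $ k < I_map h \<gamma> M lam \<beta> $ k"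
proof -
  let ?C = "C_mat h M lam \<beta>"
  have c: "0 \<le> \<beta> $ k * (\<gamma> k + 1) / \<gamma> k" for k
    using \<beta> \<gamma>[of k] by (simp add: less_eq_vec_def)
  have pos: "\<beta> $ k * (\<gamma> k + 1) / \<gamma> k * (cmod (cdot (h k) x))\<^sup>2 < quad ?C x" if "x \<noteq> 0" for k x
    using pd[of k] that by (simp add: loewner_gt_def posdef_def quad_diff quad_scaleR quad_outer)
  have C: "posdef ?C"
    unfolding posdef_def
  proof (intro conjI allI impI)
    show "hermitian ?C"
      by (rule hermitian_C_mat[OF herm])
    show "0 < quad ?C x" if "x \<noteq> 0" for x
      \<comment> \<open>Any index serves, since each subtracted rank-one term is nonnegative;
        \<open>undefined\<close> just names one.\<close>
      using pos[OF that, of undefined] mult_nonneg_nonneg[OF c[of undefined] zero_le_power2]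
      by (rule order_le_less_trans[rotated])
  qed
  note inv = invertible_posdef[OF C]
  let ?x = "\<lambda>k. matrix_inv ?C *v h k"
  have Cx: "?C *v ?x k = h k" for k
    using someI_ex[OF inv[unfolded invertible_def]]
    by (simp add: matrix_inv_def matrix_vector_mul_assoc)
  show less: "\<beta> $ k < I_map h \<gamma> M lam \<beta> $ k" for k
  proof -
    let ?s = "quad (matrix_inv ?C) (h k)"
    have x: "?x k \<noteq> 0"
      using Cx[of k] h[of k] by force
    have s: "?s = Re (cdot (h k) (?x k))"
      by (simp add: quad_def)
    \<comment> \<open>Since \<open>?C *v ?x k = h k\<close>, the two inner products are complex
      conjugates and share their real part.\<close>
    have Cs: "quad ?C (?x k) = ?s"
      unfolding s quad_def Cx by (subst cdot_commute) simp
    then have "0 < ?s"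
      using C x by (auto simp: posdef_def)
    \<comment> \<open>Bounding the real part by the modulus avoids proving that the inner product is
      real.\<close>
    have "?s\<^sup>2 \<le> (cmod (cdot (h k) (?x k)))\<^sup>2"
      unfolding s by (metis abs_Re_le_cmod abs_le_square_iff abs_norm_cancel)
    then have "\<beta> $ k * (\<gamma> k + 1) / \<gamma> k * ?s\<^sup>2 < ?s"
      using pos[OF x, of k] mult_left_mono[OF _ c[of k]] unfolding Cs by fastforce
    then have "(\<beta> $ k * (\<gamma> k + 1) / \<gamma> k * ?s) * ?s < 1 * ?s"
      by (simp add: power2_eq_square mult.assoc)
    then have "\<beta> $ k * (\<gamma> k + 1) / \<gamma> k * ?s < 1"
      using \<open>0 < ?s\<close> by (simp only: mult_less_cancel_right_pos)
    moreover have "0 < (\<gamma> k + 1) / \<gamma> k * ?s"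
      using \<open>0 < ?s\<close> \<gamma>[of k] by simp
    ultimately have "\<beta> $ k < 1 / ((\<gamma> k + 1) / \<gamma> k * ?s)"
      by (simp only: pos_less_divide_eq times_divide_eq_right times_divide_eq_left mult.assoc)
    \<comment> \<open>Invertibility selects the \<open>matrix_inv\<close> branch of
      \<open>I_map\<close>.\<close>
    then show ?thesis
      using inv by (simp add: I_map_def Let_def)
  qed
  have "h k \<in> range (\<lambda>x. ?C *v x)" for k
    by (metis Cx rangeI)
  moreover have "psd ?C"
    by (rule psd_posdef[OF C])
  ultimately show "\<beta> \<in> F_set h \<gamma> M lam"
    using \<beta> less by (simp add: F_set_def F1_set_def less_eq_vec_def less_imp_le)
qed

theorem proposition2:
  fixes h :: "'k::finite \<Rightarrow> complex ^ 'm::finite"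
    and \<gamma> \<sigma>sq :: "'k \<Rightarrow> real"
    and \<eta> :: real
    and M :: "'q::finite \<Rightarrow> complex ^ 'm ^ 'm"
    and lam_prev g :: "real ^ 'q"
    and \<beta>_star :: "real ^ 'k"
  assumes "\<And>k. \<gamma> k > 0" and "\<And>k. \<sigma>sq k > 0" and "\<eta> > 0"
    and "\<And>q. hermitian (M q)"
    and "GDB_feasible h \<gamma> \<sigma>sq \<noteq> {}"
    and "GDB_bounded h \<gamma> \<sigma>sq M lam_prev"
    and "dual_slater h \<gamma> M lam_prev"
    and "dual_optimal h \<gamma> \<sigma>sq M lam_prev \<beta>_star"
    and "update_direction (d_tilde h \<gamma> \<sigma>sq M \<eta>) g lam_prev"
  shows "\<exists>\<alpha>0>0. \<forall>\<alpha>. 0 < \<alpha> \<and> \<alpha> \<le> \<alpha>0 \<longrightarrow> \<beta>_star \<in> S_set h \<gamma> M (lam_prev + \<alpha> *\<^sub>R g)"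
proof -
  let ?R = "\<lambda>\<beta> k. (\<beta> $ k * (\<gamma> k + 1) / \<gamma> k) *\<^sub>R outer (h k)"
  let ?N = "- 2 *\<^sub>R (\<Sum>q\<in>UNIV. (g $ q) *\<^sub>R M q)"
  obtain \<beta>h where \<beta>h: "\<beta>h \<in> F_set h \<gamma> M lam_prev"
    and gt: "\<And>k. loewner_gt (C_mat h M lam_prev \<beta>h) (?R \<beta>h k)"
    using assms(7) by (auto simp: dual_slater_def)
  have h: "h k \<noteq> 0" for k
    using assms(5) GDB_feasible_nonzero[of _ h \<gamma> \<sigma>sq k] assms(2) by blast
  have nonneg: "0 \<le> \<beta>h"
    using \<beta>h by (simp add: F_set_def F1_set_def)
  have "\<beta>h \<in> dual_feasible h \<gamma> M lam_prev"
    using gt nonneg by (simp add: dual_feasible_def loewner_ge_def loewner_gt_def psd_posdef)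
  then have le: "\<beta>h \<le> \<beta>_star"
    by (rule dual_optimal_greatest[OF assms(4) assms(2) assms(8)])
  have "hermitian ?N"
    by (intro hermitian_scaleR hermitian_sum assms(4))
  \<comment> \<open>The point \<open>\<beta>h\<close> is held fixed while \<open>lam\<close> moves,
    so the rank-one term stays put and only \<open>C_mat\<close> is perturbed.\<close>
  then have "\<forall>\<^sub>F \<alpha> in at_right 0. posdef (C_mat h M lam_prev \<beta>h - ?R \<beta>h k + \<alpha> *\<^sub>R ?N)" for k
    using gt[of k] posdef_perturb unfolding loewner_gt_def by blast
  then have "\<forall>\<^sub>F \<alpha> in at_right 0. loewner_gt (C_mat h M (lam_prev + \<alpha> *\<^sub>R g) \<beta>h) (?R \<beta>h k)" for k
    unfolding loewner_gt_def C_mat_step by (simp only: diff_add_eq)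
  \<comment> \<open>Finiteness of the index type gives one step-size threshold for all
    \<open>k\<close>.\<close>
  then have "\<forall>\<^sub>F \<alpha> in at_right 0. \<forall>k. loewner_gt (C_mat h M (lam_prev + \<alpha> *\<^sub>R g) \<beta>h) (?R \<beta>h k)"
    by (rule eventually_all_finite)
  then have "\<forall>\<^sub>F \<alpha> in at_right 0. \<beta>_star \<in> S_set h \<gamma> M (lam_prev + \<alpha> *\<^sub>R g)"
  proof eventually_elim
    case (elim \<alpha>)
    then have "loewner_gt (C_mat h M (lam_prev + \<alpha> *\<^sub>R g) \<beta>h) (?R \<beta>h k)" for k
      by (rule spec)
    note * = strictly_feasible_imp[OF assms(1) h assms(4) nonneg this]
    show ?case
      unfolding S_set_def by (rule UnionI[of "{\<beta>. \<beta>h \<le> \<beta>}"]) (use * le in auto)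
  qed
  then obtain b where "b > 0" "\<And>\<alpha>. 0 < \<alpha> \<Longrightarrow> \<alpha> < b \<Longrightarrow> \<beta>_star \<in> S_set h \<gamma> M (lam_prev + \<alpha> *\<^sub>R g)"
    by (auto simp: eventually_at_right_field)
  then show ?thesis
    \<comment> \<open>The filter yields the open condition \<open>\<alpha> < b\<close>; halving
      \<open>b\<close> makes room for \<open>\<alpha> \<le> \<alpha>0\<close>.\<close>
    by (intro exI[of _ "b / 2"]) auto
qed

end
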